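(* Let $A\in\mathbb{C}^{n\times n}$, let $\mathbf{b}\in\mathbb{C}^n$ be nonzero, let $N$ be the Arnoldi termination index of $(A,\mathbf{b})$, let $\mathbf{v}_1,\dots,\mathbf{v}_N$ be the Arnoldi vectors and $q_0,\dots,q_{N-1}$ the associated orthonormal polynomials. Let $\delta\in\mathbb{C}$ and $0\le k\le N-1$. Then the $k$th GMRES residual $\mathbf{r}_k(\delta)$ for the shifted system $(A-\delta I_n)\mathbf{x}=\mathbf{b}$ with starting vector $\mathbf{x}_0=0$ can be written as $$\mathbf{r}_k(\delta)=p_k(A)\,\mathbf{r}_0(\delta),\qquad\text{where}\quad p_k(z)=\frac{1}{\sigma_k(\delta)^2}\sum_{j=0}^k\overline{q_j(\delta)}\,q_j(z).$$ For its normalized version $\mathbf{w}_k(\delta)$ we have $$\mathbf{w}_k(\delta)=\frac{\mathbf{r}_k(\delta)}{\|\mathbf{r}_k(\delta)\|}=\frac{1}{\sigma_k(\delta)}\sum_{j=0}^k\overline{q_j(\delta)}\,\mathbf{v}_{j+1}.$$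
   Context: Arnoldi process: starting from $\mathbf{v}_1=\mathbf{b}/\|\mathbf{b}\|$, the Arnoldi process produces orthonormal vectors $\mathbf{v}_1,\mathbf{v}_2,\dots$ and scalars $h_{j,k}=\mathbf{v}_j^*A\mathbf{v}_k$ with $A\mathbf{v}_k=\sum_{j=1}^{k+1}h_{j,k}\mathbf{v}_j$, $h_{k+1,k}\ge 0$. It terminates at the Arnoldi termination index $N\le n$, the first index for which $\mathbf{v}_{N+1}=0$ (i.e. $A\mathbf{v}_N\in\mathrm{span}\{\mathbf{v}_1,\dots,\mathbf{v}_N\}$); thus $h_{k+1,k}>0$ for $1\le k\le N-1$. Polynomials: $q_0(z)=1$ and, for $1\le k\le N-1$, $h_{k+1,k}\,q_k(z)=z\,q_{k-1}(z)-\sum_{j=1}^k h_{j,k}\,q_{j-1}(z)$. Set $\sigma_k(z)=\sqrt{\sum_{j=0}^k|q_j(z)|^2}$. GMRES residual: $\mathbf{r}_0(\delta)=\mathbf{b}$, and for $k\ge 1$, $\mathbf{r}_k(\delta)=\mathbf{b}-\mathbf{u}_k$, where $\mathbf{u}_k$ is the minimizer of $\|\mathbf{b}-\mathbf{u}\|$ over $\mathbf{u}\in(A-\delta I_n)\,\mathrm{span}\{\mathbf{v}_1,\dots,\mathbf{v}_k\}$. Norms are Euclidean. *)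

theory Defs
  imports "HOL-Analysis.Analysis" "HOL-Computational_Algebra.Polynomial"
begin

(* Hermitian form x^* y, conjugate-linear in the first argument. The library's inner product on
   complex ^ 'n is only its real part; the library norm is already the Euclidean norm. *)
definition herm :: "complex ^ 'n \<Rightarrow> complex ^ 'n \<Rightarrow> complex" where
  "herm x y = (\<Sum>i\<in>UNIV. cnj (x $ i) * y $ i)"

(* The value at index 0 is a dummy: the Arnoldi vectors are v_1, v_2, ...
   Since 1 / 0 = 0, breakdown yields the zero vector, and all later vectors are zero too. *)
fun arnoldi_vec :: "complex ^ 'n ^ 'n \<Rightarrow> complex ^ 'n \<Rightarrow> nat \<Rightarrow> complex ^ 'n" where
  "arnoldi_vec A b 0 = 0"
| "arnoldi_vec A b (Suc 0) = (1 / norm b) *\<^sub>R b"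
| "arnoldi_vec A b (Suc (Suc k)) =
     (let u = A *v arnoldi_vec A b (Suc k);
          w = u - (\<Sum>j=1..Suc k. herm (arnoldi_vec A b j) u *s arnoldi_vec A b j)
      in (1 / norm w) *\<^sub>R w)"

definition arnoldi_coeff :: "complex ^ 'n ^ 'n \<Rightarrow> complex ^ 'n \<Rightarrow> nat \<Rightarrow> nat \<Rightarrow> complex" where
  "arnoldi_coeff A b j k = herm (arnoldi_vec A b j) (A *v arnoldi_vec A b k)"

definition arnoldi_index :: "complex ^ 'n ^ 'n \<Rightarrow> complex ^ 'n \<Rightarrow> nat" where
  "arnoldi_index A b = (LEAST k. 1 \<le> k \<and> arnoldi_vec A b (k + 1) = 0)"

(* Meaningful only for indices below arnoldi_index A b, where the divisor is nonzero;
   [:0, 1:] is the polynomial z. *)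
fun arnoldi_poly :: "complex ^ 'n ^ 'n \<Rightarrow> complex ^ 'n \<Rightarrow> nat \<Rightarrow> complex poly" where
  "arnoldi_poly A b 0 = 1"
| "arnoldi_poly A b (Suc k) =
     smult (1 / arnoldi_coeff A b (Suc k + 1) (Suc k))
       ([:0, 1:] * arnoldi_poly A b k
        - (\<Sum>j=1..Suc k. smult (arnoldi_coeff A b j (Suc k)) (arnoldi_poly A b (j - 1))))"

definition arnoldi_sigma :: "complex ^ 'n ^ 'n \<Rightarrow> complex ^ 'n \<Rightarrow> nat \<Rightarrow> complex \<Rightarrow> real" where
  "arnoldi_sigma A b k z = sqrt (\<Sum>j=0..k. (cmod (poly (arnoldi_poly A b j) z))\<^sup>2)"

(* The library's multiplication and powers of matrices act entrywise, so powers and polynomials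
   of a matrix have to be built from the matrix product; mat c is c times the identity. *)
primrec mat_power :: "complex ^ 'n ^ 'n \<Rightarrow> nat \<Rightarrow> complex ^ 'n ^ 'n" where
  "mat_power A 0 = mat 1"
| "mat_power A (Suc k) = A ** mat_power A k"

definition poly_mat :: "complex poly \<Rightarrow> complex ^ 'n ^ 'n \<Rightarrow> complex ^ 'n ^ 'n" where
  "poly_mat p A = (\<Sum>i\<le>degree p. mat (coeff p i) ** mat_power A i)"

(* vec.span is the complex span; the unqualified span would be the real one. *)
definition gmres_space ::
    "complex ^ 'n ^ 'n \<Rightarrow> complex ^ 'n \<Rightarrow> complex \<Rightarrow> nat \<Rightarrow> (complex ^ 'n) set" where
  "gmres_space A b \<delta> k = (\<lambda>x. (A - mat \<delta>) *v x) ` vec.span (arnoldi_vec A b ` {1..k})"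

(* closest_point S b is the minimizer of dist b u = norm (b - u) over u in S,
   unique here because S is a linear subspace. *)
definition gmres_residual ::
    "complex ^ 'n ^ 'n \<Rightarrow> complex ^ 'n \<Rightarrow> complex \<Rightarrow> nat \<Rightarrow> complex ^ 'n" where
  "gmres_residual A b \<delta> k =
     (if k = 0 then b else b - closest_point (gmres_space A b \<delta> k) b)"

definition gmres_residual_normalized ::
    "complex ^ 'n ^ 'n \<Rightarrow> complex ^ 'n \<Rightarrow> complex \<Rightarrow> nat \<Rightarrow> complex ^ 'n" where
  "gmres_residual_normalized A b \<delta> k =
     (1 / norm (gmres_residual A b \<delta> k)) *\<^sub>R gmres_residual A b \<delta> k"

end

theory Submission
  imports Defs
begin

text \<open>
  By induction, \<open>q\<^sub>j(A) b = \<parallel>b\<parallel> v\<^sub>j\<^sub>+\<^sub>1\<close>, so the claimed residual is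
  \<open>r = \<parallel>b\<parallel> \<sigma>\<^sup>-\<^sup>2 s\<close> with \<open>s = \<Sum>\<^sub>j cnj (q\<^sub>j(\<delta>)) v\<^sub>j\<^sub>+\<^sub>1\<close>. Evaluating the recurrence of
  the \<open>q\<^sub>j\<close> at \<open>\<delta>\<close> shows that \<open>s\<close> is orthogonal to every \<open>(A - \<delta>) v\<^sub>m\<close>, \<open>m \<le> k\<close>, and,
  compared with the Arnoldi relation, that \<open>v\<^sub>j\<^sub>+\<^sub>1 - q\<^sub>j(\<delta>) v\<^sub>1\<close> lies in
  \<open>(A - \<delta>) span {v\<^sub>1, ..., v\<^sub>k}\<close>. The latter puts \<open>b - r\<close> in this space because
  \<open>\<sigma>\<^sup>2 = \<Sum>\<^sub>j \<bar>q\<^sub>j(\<delta>)\<bar>\<^sup>2\<close>, and so \<open>b - r\<close> is the orthogonal projection of \<open>b\<close> onto it.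
\<close>

declare arnoldi_vec.simps [simp del]

section \<open>The Hermitian form and scalar matrices\<close>

lemma herm_add_right: "herm x (y + z) = herm x y + herm x z"
  by (simp add: herm_def algebra_simps sum.distrib)

lemma herm_diff_right: "herm x (y - z) = herm x y - herm x z"
  by (simp add: herm_def algebra_simps sum_subtractf)

lemma herm_scale_right: "herm x (c *s y) = c * herm x y"
  by (simp add: herm_def sum_distrib_left algebra_simps)

lemma herm_zero_right [simp]: "herm x 0 = 0"
  by (simp add: herm_def)

lemma herm_sum_right: "herm x (\<Sum>i\<in>I. f i) = (\<Sum>i\<in>I. herm x (f i))"
  by (induction I rule: infinite_finite_induct) (simp_all add: herm_add_right)

lemma cnj_herm: "cnj (herm x y) = herm y x"
  by (simp add: herm_def mult.commute)

lemma herm_self: "herm x x = complex_of_real ((norm x)\<^sup>2)"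
proof -
  have "(norm x)\<^sup>2 = (\<Sum>i\<in>UNIV. (norm (x $ i))\<^sup>2)"
    by (simp add: norm_vec_def L2_set_def sum_nonneg)
  then show ?thesis
    unfolding herm_def using complex_norm_square by (simp add: mult.commute)
qed

lemma inner_eq_Re_herm: "x \<bullet> y = Re (herm x y)"
  by (simp add: herm_def inner_vec_def inner_complex_def)

lemma scaleR_eq_scalar_mult: "r *\<^sub>R (x :: complex ^ 'n) = complex_of_real r *s x"
  by (simp add: vec_eq_iff scaleR_conv_of_real[where 'a = complex])

lemma mat_vector_mult: "mat c *v x = c *s (x :: complex ^ 'n)"
  by (simp add: vec_eq_iff matrix_vector_mult_def mat_def if_distrib if_distribR cong: if_cong)

section \<open>Polynomials of a matrix, applied to a vector\<close>

lemma matrix_vector_mult_sum_left: "(\<Sum>i\<in>I. M i) *v x = (\<Sum>i\<in>I. M i *v (x :: complex ^ 'n))"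
  by (induction I rule: infinite_finite_induct) (simp_all add: matrix_vector_mult_add_rdistrib)

text \<open>Coefficients above the degree vanish, so any upper bound may serve as summation limit. A
  common limit lets polynomials of different degrees be compared term by term.\<close>

lemma poly_mat_vector_mult:
  assumes "degree p \<le> m"
  shows "poly_mat p A *v x = (\<Sum>i\<le>m. coeff p i *s (mat_power A i *v x))"
proof -
  have "poly_mat p A *v x = (\<Sum>i\<le>degree p. coeff p i *s (mat_power A i *v x))"
    by (simp add: poly_mat_def matrix_vector_mult_sum_left mat_vector_mult
        flip: matrix_vector_mul_assoc)
  also have "\<dots> = (\<Sum>i\<le>m. coeff p i *s (mat_power A i *v x))"
    using assms by (intro sum.mono_neutral_left) (auto simp: coeff_eq_0)
  finally show ?thesis .
qed

lemma poly_mat_0: "poly_mat 0 A *v x = 0"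
  by (simp add: poly_mat_vector_mult[of _ 0])

lemma poly_mat_1: "poly_mat 1 A *v x = x"
  by (simp add: poly_mat_vector_mult[of _ 0])

lemma poly_mat_add: "poly_mat (p + q) A *v x = poly_mat p A *v x + poly_mat q A *v x"
proof -
  let ?m = "max (degree p) (degree q)"
  have "degree (p + q) \<le> ?m" by (rule degree_add_le_max)
  then show ?thesis
    by (simp add: poly_mat_vector_mult[of _ ?m] sum.distrib vec.scale_left_distrib)
qed

lemma poly_mat_smult: "poly_mat (smult c p) A *v x = c *s (poly_mat p A *v x)"
  by (simp add: poly_mat_vector_mult[of _ "degree p"] degree_smult_le vec.scale_sum_right)

lemma poly_mat_diff: "poly_mat (p - q) A *v x = poly_mat p A *v x - poly_mat q A *v x"
  using poly_mat_add[of p "smult (-1) q" A x] poly_mat_smult[of "-1" q A x] by simp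

lemma poly_mat_sum: "poly_mat (\<Sum>i\<in>I. p i) A *v x = (\<Sum>i\<in>I. poly_mat (p i) A *v x)"
  by (induction I rule: infinite_finite_induct) (simp_all add: poly_mat_add poly_mat_0)

text \<open>Shifting the coefficients by one adds one factor \<open>A\<close> to every power. The
  simplifier turns the product \<open>[:0, 1:] * p\<close> of the recurrence into
  \<open>pCons 0 p\<close>.\<close>

lemma poly_mat_pCons_0: "poly_mat (pCons 0 p) A *v x = A *v (poly_mat p A *v x)"
proof -
  have "poly_mat (pCons 0 p) A *v x
      = (\<Sum>i\<le>Suc (degree p). coeff (pCons 0 p) i *s (mat_power A i *v x))"
    by (rule poly_mat_vector_mult) (rule degree_pCons_le)
  also have "\<dots> = A *v (poly_mat p A *v x)"
    by (simp add: sum.atMost_Suc_shift poly_mat_vector_mult[of p "degree p"]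
        vec.linear_sum[OF matrix_vector_mul_linear_gen] vec.scale del: sum.atMost_Suc
        flip: matrix_vector_mul_assoc)
  finally show ?thesis .
qed

section \<open>Arnoldi vectors and polynomials: orthonormality and recurrences\<close>

lemma arnoldi_vec_step:
  assumes "arnoldi_vec A b (Suc (Suc l)) \<noteq> 0"
  obtains w c where "c \<noteq> 0" and "arnoldi_vec A b (Suc (Suc l)) = complex_of_real (1 / c) *s w"
    and "w = A *v arnoldi_vec A b (Suc l) -
        (\<Sum>j=1..Suc l. arnoldi_coeff A b j (Suc l) *s arnoldi_vec A b j)"
proof -
  define w where "w = A *v arnoldi_vec A b (Suc l) -
        (\<Sum>j=1..Suc l. arnoldi_coeff A b j (Suc l) *s arnoldi_vec A b j)"
  have eq: "arnoldi_vec A b (Suc (Suc l)) = (1 / norm w) *\<^sub>R w"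
    by (simp add: w_def arnoldi_coeff_def arnoldi_vec.simps Let_def)
  \<comment> \<open>Breakdown, with \<open>norm w = 0\<close>, would yield the zero vector by
    division by zero; without it the normalisation can be undone.\<close>
  then have "norm w \<noteq> 0" using assms by auto
  then show thesis using that[of "norm w" w] eq by (simp add: w_def scaleR_eq_scalar_mult)
qed

lemma arnoldi_vec_norm:
  assumes "arnoldi_vec A b j \<noteq> 0"
  shows "norm (arnoldi_vec A b j) = 1"
proof (cases "(A, b, j)" rule: arnoldi_vec.cases)
  case (3 A' b' l)
  then obtain w where "arnoldi_vec A b j = (1 / norm w) *\<^sub>R w"
    by (auto simp: arnoldi_vec.simps Let_def)
  with assms show ?thesis by auto
qed (use assms in \<open>auto simp: arnoldi_vec.simps\<close>)

lemma arnoldi_vec_orthonormal: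
  assumes "\<forall>j\<in>{1..m}. arnoldi_vec A b j \<noteq> 0"
    and "i \<in> {1..m}" "j \<in> {1..m}"
  shows "herm (arnoldi_vec A b i) (arnoldi_vec A b j) = (if i = j then 1 else 0)"
  using assms
proof (induction m arbitrary: i j)
  case 0
  then show ?case by simp
next
  case (Suc m)
  let ?v = "arnoldi_vec A b"
  have IH: "herm (?v i) (?v j) = (if i = j then 1 else 0)" if "i \<in> {1..m}" "j \<in> {1..m}" for i j
    using Suc.IH[of i j] Suc.prems(1) that by force
  have new: "herm (?v i) (?v (Suc m)) = 0" if i: "i \<in> {1..m}" for i
  proof -
    from i obtain l where l: "m = Suc l" by (cases m) auto
    let ?h = "\<lambda>j. arnoldi_coeff A b j m"
    have "?v (Suc (Suc l)) \<noteq> 0" using Suc.prems(1) l by auto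
    then obtain w c where c: "?v (Suc m) = complex_of_real (1 / c) *s w"
      and w: "w = A *v ?v m - (\<Sum>j=1..m. ?h j *s ?v j)"
      unfolding l by (rule arnoldi_vec_step)
    \<comment> \<open>By the induction hypothesis the subtracted projections contribute only
      \<open>?h i\<close>, which is exactly the component of \<open>A *v ?v m\<close> along
      \<open>?v i\<close>.\<close>
    have "herm (?v i) w = ?h i - (\<Sum>j=1..m. ?h j * herm (?v i) (?v j))"
      by (simp add: w herm_diff_right herm_sum_right herm_scale_right arnoldi_coeff_def)
    also have "(\<Sum>j=1..m. ?h j * herm (?v i) (?v j)) = (\<Sum>j=1..m. if i = j then ?h j else 0)"
      using i by (intro sum.cong) (auto simp: IH)
    also have "\<dots> = ?h i" using i by simp
    finally show ?thesis by (simp add: c herm_scale_right)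
  qed
  have "herm (?v (Suc m)) (?v i) = 0" if "i \<in> {1..m}" for i
    using new[OF that] cnj_herm[of "?v i" "?v (Suc m)"] by simp
  moreover have "herm (?v (Suc m)) (?v (Suc m)) = 1"
    using Suc.prems(1) by (simp add: herm_self arnoldi_vec_norm)
  ultimately show ?case
    using Suc.prems(2,3) new IH by (cases "i = Suc m"; cases "j = Suc m") auto
qed

lemma arnoldi_relation:
  assumes nz: "\<forall>j\<in>{1..Suc (Suc l)}. arnoldi_vec A b j \<noteq> 0"
  shows "A *v arnoldi_vec A b (Suc l) =
      (\<Sum>j=1..Suc (Suc l). arnoldi_coeff A b j (Suc l) *s arnoldi_vec A b j)" (is ?rel)
    and "arnoldi_coeff A b (Suc (Suc l)) (Suc l) \<noteq> 0" (is ?nz)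
proof -
  let ?v = "arnoldi_vec A b" and ?h = "\<lambda>j. arnoldi_coeff A b j (Suc l)"
  have "?v (Suc (Suc l)) \<noteq> 0" using nz by simp
  then obtain w c where "c \<noteq> 0" and v: "?v (Suc (Suc l)) = complex_of_real (1 / c) *s w"
    and w: "w = A *v ?v (Suc l) - (\<Sum>j=1..Suc l. ?h j *s ?v j)"
    by (rule arnoldi_vec_step)
  have wv: "w = complex_of_real c *s ?v (Suc (Suc l))"
    using \<open>c \<noteq> 0\<close> by (simp add: v)
  have Av: "A *v ?v (Suc l) = complex_of_real c *s ?v (Suc (Suc l)) + (\<Sum>j=1..Suc l. ?h j *s ?v j)"
    using w wv by simp
  have orth: "herm (?v (Suc (Suc l))) (?v j) = (if Suc (Suc l) = j then 1 else 0)"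
    if "j \<in> {1..Suc (Suc l)}" for j
    using arnoldi_vec_orthonormal[OF nz, of "Suc (Suc l)" j] that by simp
  \<comment> \<open>Pairing with the newest vector removes every other term and so identifies the
    normalising constant \<open>c\<close> with the subdiagonal coefficient.\<close>
  have "?h (Suc (Suc l)) = complex_of_real c * herm (?v (Suc (Suc l))) (?v (Suc (Suc l)))
      + (\<Sum>j=1..Suc l. ?h j * herm (?v (Suc (Suc l))) (?v j))"
    unfolding arnoldi_coeff_def[of A b "Suc (Suc l)"] Av
    by (simp only: herm_add_right herm_scale_right herm_sum_right)
  also have "(\<Sum>j=1..Suc l. ?h j * herm (?v (Suc (Suc l))) (?v j)) = 0"
    by (intro sum.neutral) (simp add: orth)
  finally have h: "?h (Suc (Suc l)) = complex_of_real c"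
    by (simp add: orth)
  then show ?nz using \<open>c \<noteq> 0\<close> by simp
  show ?rel using Av h by (simp add: add_ac)
qed

text \<open>Brings the recurrence into the shape of \<open>arnoldi_relation\<close>, with polynomial
  values in place of vectors. The shift \<open>j - 1\<close> arises because polynomials are numbered
  from 0 and vectors from 1.\<close>

lemma poly_arnoldi_poly_Suc:
  assumes "arnoldi_coeff A b (Suc (Suc l)) (Suc l) \<noteq> 0"
  shows "z * poly (arnoldi_poly A b l) z =
      (\<Sum>j=1..Suc (Suc l). arnoldi_coeff A b j (Suc l) * poly (arnoldi_poly A b (j - 1)) z)"
  using assms by (simp add: poly_sum)

text \<open>Both sides start from \<open>b\<close> and obey the same recurrence. The induction is
  strong because each step refers to all earlier indices.\<close>

lemma poly_mat_arnoldi_poly: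
  assumes "b \<noteq> 0" and "\<forall>j\<in>{1..Suc m}. arnoldi_vec A b j \<noteq> 0"
  shows "poly_mat (arnoldi_poly A b m) A *v b = complex_of_real (norm b) *s arnoldi_vec A b (Suc m)"
  using assms(2)
proof (induction m rule: less_induct)
  case (less m)
  let ?v = "arnoldi_vec A b" and ?q = "arnoldi_poly A b" and ?\<beta> = "complex_of_real (norm b)"
  show ?case
  proof (cases m)
    case 0
    then show ?thesis using assms(1) by (simp add: arnoldi_vec.simps poly_mat_1 scaleR_eq_scalar_mult)
  next
    case (Suc l)
    let ?h = "\<lambda>j. arnoldi_coeff A b j (Suc l)"
    have IH: "poly_mat (?q i) A *v b = ?\<beta> *s ?v (Suc i)" if "i < m" for i
      using less.IH[OF that] less.prems that by auto
    note rel = arnoldi_relation[of l A b, OF less.prems[unfolded Suc]]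
    have "poly_mat (?q m) A *v b = (1 / ?h (Suc (Suc l))) *s
        (A *v (?\<beta> *s ?v (Suc l)) - (\<Sum>j=1..Suc l. ?h j *s (poly_mat (?q (j - 1)) A *v b)))"
      using IH[of l] Suc
      by (simp add: poly_mat_smult poly_mat_diff poly_mat_sum poly_mat_pCons_0
          del: sum.cl_ivl_Suc)
    also have "(\<Sum>j=1..Suc l. ?h j *s (poly_mat (?q (j - 1)) A *v b))
        = (\<Sum>j=1..Suc l. ?h j *s (?\<beta> *s ?v j))"
      using Suc by (intro sum.cong) (auto simp: IH)
    also have "A *v (?\<beta> *s ?v (Suc l)) - \<dots> = ?\<beta> *s (?h (Suc (Suc l)) *s ?v (Suc (Suc l)))"
      using rel(1) by (simp add: vec.scale vec.scale_sum_right vec.scale_right_distrib mult_ac)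
    finally show ?thesis using rel(2) Suc by simp
  qed
qed

section \<open>The GMRES space and its orthogonal complement\<close>

lemma subspace_gmres_space: "vec.subspace (gmres_space A b \<delta> k)"
  unfolding gmres_space_def
  by (intro vec.subspace_image vec.subspace_span matrix_vector_mul_linear_gen)

lemma arnoldi_vec_diff_in_gmres_space:
  assumes nz: "\<forall>j\<in>{1..Suc k}. arnoldi_vec A b j \<noteq> 0"
    and "m \<le> k"
  shows "arnoldi_vec A b (Suc m) - poly (arnoldi_poly A b m) \<delta> *s arnoldi_vec A b 1
    \<in> gmres_space A b \<delta> k"
  using \<open>m \<le> k\<close>
proof (induction m rule: less_induct)
  case (less m)
  let ?v = "arnoldi_vec A b" and ?q = "\<lambda>i. poly (arnoldi_poly A b i) \<delta>"
  let ?S = "gmres_space A b \<delta> k"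
  define d where "d j = ?v j - ?q (j - 1) *s ?v 1" for j
  note sub = subspace_gmres_space[of A b \<delta> k]
  show ?case
  proof (cases m)
    case 0
    then show ?thesis using vec.subspace_0[OF sub] by simp
  next
    case (Suc l)
    let ?h = "\<lambda>j. arnoldi_coeff A b j (Suc l)"
    have nz': "\<forall>j\<in>{1..Suc (Suc l)}. ?v j \<noteq> 0"
      using nz less.prems Suc by auto
    note rel = arnoldi_relation[of l A b, OF nz']
    have d: "d j \<in> ?S" if "1 \<le> j" "j \<le> Suc l" for j
      using less.IH[of "j - 1"] that less.prems Suc by (auto simp: d_def)
    \<comment> \<open>The Arnoldi relation minus \<open>?v 1\<close> times the scalar recurrence at
      \<delta>: equal coefficients pair the terms into the \<open>d j\<close>.\<close>
    have "A *v ?v (Suc l) - (\<delta> * ?q l) *s ?v 1 = (\<Sum>j=1..Suc (Suc l). ?h j *s d j)"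
      unfolding rel(1) poly_arnoldi_poly_Suc[OF rel(2)] d_def
      by (simp only: vec.scale_right_diff_distrib sum_subtractf vec.scale_scale flip: vec.scale_sum_left)
    moreover have "A *v ?v (Suc l) - (\<delta> * ?q l) *s ?v 1 = (A - mat \<delta>) *v ?v (Suc l) + \<delta> *s d (Suc l)"
      by (simp add: d_def matrix_vector_mult_diff_rdistrib mat_vector_mult
          vec.scale_right_diff_distrib)
    \<comment> \<open>Only the last \<open>d\<close> is new. Its coefficient is nonzero, so
      membership of the right-hand side carries over to it.\<close>
    ultimately have "?h (Suc (Suc l)) *s d (Suc (Suc l)) =
        (A - mat \<delta>) *v ?v (Suc l) + \<delta> *s d (Suc l) - (\<Sum>j=1..Suc l. ?h j *s d j)"
      by (simp add: eq_diff_eq add_ac)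
    also have "\<dots> \<in> ?S"
    proof (intro vec.subspace_add vec.subspace_diff vec.subspace_sum vec.subspace_scale sub)
      show "(A - mat \<delta>) *v ?v (Suc l) \<in> ?S"
        unfolding gmres_space_def using less.prems Suc
        by (intro imageI vec.span_base) auto
    qed (use d in auto)
    finally have "(1 / ?h (Suc (Suc l))) *s (?h (Suc (Suc l)) *s d (Suc (Suc l))) \<in> ?S"
      by (rule vec.subspace_scale[OF sub])
    then show ?thesis using rel(2) Suc by (simp add: d_def del: arnoldi_poly.simps(2))
  qed
qed

lemma herm_sum_arnoldi_vec:
  assumes nz: "\<forall>j\<in>{1..Suc k}. arnoldi_vec A b j \<noteq> 0"
    and "i \<le> k"
  shows "herm (arnoldi_vec A b (Suc i)) (\<Sum>j=0..k. c j *s arnoldi_vec A b (Suc j)) = c i"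
proof -
  have "herm (arnoldi_vec A b (Suc i)) (\<Sum>j=0..k. c j *s arnoldi_vec A b (Suc j))
      = (\<Sum>j=0..k. if i = j then c j else 0)"
    unfolding herm_sum_right using \<open>i \<le> k\<close>
    by (intro sum.cong)
       (simp_all add: herm_scale_right arnoldi_vec_orthonormal[OF nz])
  then show ?thesis using \<open>i \<le> k\<close> by simp
qed

lemma herm_kernel_gmres_space:
  assumes nz: "\<forall>j\<in>{1..Suc k}. arnoldi_vec A b j \<noteq> 0"
    and y: "y \<in> gmres_space A b \<delta> k"
  shows "herm (\<Sum>j=0..k. cnj (poly (arnoldi_poly A b j) \<delta>) *s arnoldi_vec A b (Suc j)) y = 0"
    (is "herm ?s y = 0")
proof -
  let ?v = "arnoldi_vec A b" and ?q = "\<lambda>i. poly (arnoldi_poly A b i) \<delta>"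
  \<comment> \<open>The conjugated coefficients cancel the conjugation in the first argument of
    \<open>herm\<close>. The range must reach \<open>Suc k\<close>, since \<open>A *v ?v k\<close>
    involves \<open>?v (Suc k)\<close>.\<close>
  have s: "herm ?s (?v j) = ?q (j - 1)" if "1 \<le> j" "j \<le> Suc k" for j
    using herm_sum_arnoldi_vec[OF nz, of "j - 1" "\<lambda>j. cnj (?q j)"] that
    by (subst cnj_herm[symmetric]) (simp)
  have gen: "herm ?s ((A - mat \<delta>) *v ?v m) = 0" if "m \<in> {1..k}" for m
  proof -
    from that obtain l where l: "m = Suc l" by (cases m) auto
    have nz': "\<forall>j\<in>{1..Suc (Suc l)}. ?v j \<noteq> 0"
      using nz that l by auto
    note rel = arnoldi_relation[of l A b, OF nz']
    \<comment> \<open>Pairing with \<open>?s\<close> turns the Arnoldi relation into the scalar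
      recurrence at \<delta>, so \<open>A\<close> acts like multiplication by \<delta> under this
      pairing.\<close>
    have "herm ?s (A *v ?v m) = (\<Sum>j=1..Suc (Suc l). arnoldi_coeff A b j (Suc l) * ?q (j - 1))"
      using that unfolding l rel(1) herm_sum_right herm_scale_right
      by (intro sum.cong refl) (simp add: s)
    also have "\<dots> = \<delta> * ?q l"
      using poly_arnoldi_poly_Suc[OF rel(2)] by simp
    also have "\<dots> = herm ?s (\<delta> *s ?v m)"
      using that l by (simp add: herm_scale_right s)
    finally show ?thesis
      by (simp add: matrix_vector_mult_diff_rdistrib mat_vector_mult herm_diff_right)
  qed
  obtain x where x: "x \<in> vec.span (?v ` {1..k})" "y = (A - mat \<delta>) *v x"
    using y by (auto simp: gmres_space_def)
  from x(1) have "herm ?s ((A - mat \<delta>) *v x) = 0"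
  proof (induction rule: vec.span_induct_alt)
    case base
    then show ?case by simp
  next
    case (step c u x)
    then show ?case using gen
      by (auto simp: matrix_vector_right_distrib vec.scale herm_add_right herm_scale_right)
  qed
  then show ?thesis using x(2) by simp
qed

text \<open>A complex subspace is also a closed convex real one, and the real inner product is the
  real part of \<open>herm\<close>. Pythagoras makes \<open>u\<close> a minimizer, and convexity
  makes it the only one.\<close>

lemma closest_point_subspace_unique:
  fixes S :: "(complex ^ 'n) set"
  assumes "vec.subspace S" and "u \<in> S" and orth: "\<And>y. y \<in> S \<Longrightarrow> herm (b - u) y = 0"
  shows "closest_point S b = u"
proof -
  have sub: "subspace S"
    using assms(1) by (auto simp: subspace_def vec.subspace_def scaleR_eq_scalar_mult)
  have "dist b u \<le> dist b z" if "z \<in> S" for z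
  proof -
    have "orthogonal (b - u) (u - z)"
      using orth[of "u - z"] that assms(1,2)
      by (simp add: orthogonal_def inner_eq_Re_herm vec.subspace_diff)
    then have "(norm (b - u + (u - z)))\<^sup>2 = (norm (b - u))\<^sup>2 + (norm (u - z))\<^sup>2"
      by (rule norm_add_Pythagorean)
    then have "(norm (b - u))\<^sup>2 \<le> (norm (b - z))\<^sup>2" by simp
    then show ?thesis by (simp add: dist_norm)
  qed
  then show ?thesis
    using closest_point_unique[OF subspace_imp_convex[OF sub] closed_subspace[OF sub] \<open>u \<in> S\<close>]
    by metis
qed

theorem proposition2p6:
  fixes A :: "complex ^ 'n ^ 'n" and b :: "complex ^ 'n" and \<delta> :: complex and k :: nat
  assumes "b \<noteq> 0" and "k \<le> arnoldi_index A b - 1"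
  shows "gmres_residual A b \<delta> k =
           poly_mat
             (smult (complex_of_real (1 / (arnoldi_sigma A b k \<delta>)\<^sup>2))
               (\<Sum>j=0..k. smult (cnj (poly (arnoldi_poly A b j) \<delta>)) (arnoldi_poly A b j))) A
           *v gmres_residual A b \<delta> 0
       \<and> gmres_residual A b \<delta> k \<noteq> 0
       \<and> gmres_residual_normalized A b \<delta> k =
           (1 / arnoldi_sigma A b k \<delta>) *\<^sub>R
             (\<Sum>j=0..k. cnj (poly (arnoldi_poly A b j) \<delta>) *s arnoldi_vec A b (j + 1))"
proof -
  let ?v = "arnoldi_vec A b" and ?q = "\<lambda>i. poly (arnoldi_poly A b i) \<delta>"
  let ?S = "gmres_space A b \<delta> k"
  define \<sigma> where "\<sigma> = arnoldi_sigma A b k \<delta>"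
  define \<beta> where "\<beta> = norm b"
  define s where "s = (\<Sum>j=0..k. cnj (?q j) *s ?v (Suc j))"
  define r where "r = (\<beta> / \<sigma>\<^sup>2) *\<^sub>R s"
  have "?v j \<noteq> 0" if "1 \<le> j" "j \<le> Suc k" for j
  proof (cases "j = 1")
    case True
    then show ?thesis using assms(1) by (simp add: arnoldi_vec.simps)
  next
    case False
    \<comment> \<open>Here \<open>j - 1\<close> is at least 1 and below the least index whose
      successor vector vanishes.\<close>
    with that assms(2) have "j - 1 < arnoldi_index A b" by linarith
    then show ?thesis
      using not_less_Least[of "j - 1" "\<lambda>k. 1 \<le> k \<and> ?v (k + 1) = 0"] that False
      by (auto simp: arnoldi_index_def)
  qed
  then have nz: "\<forall>j\<in>{1..Suc k}. ?v j \<noteq> 0" by simp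
  have \<sigma>2: "\<sigma>\<^sup>2 = (\<Sum>j=0..k. (cmod (?q j))\<^sup>2)"
    by (simp add: \<sigma>_def arnoldi_sigma_def sum_nonneg)
  \<comment> \<open>Since \<open>q_0 = 1\<close>, this keeps \<sigma> away from zero.\<close>
  have "(cmod (?q 0))\<^sup>2 \<le> \<sigma>\<^sup>2"
    unfolding \<sigma>2 by (rule member_le_sum) auto
  moreover have "\<sigma> \<ge> 0" by (simp add: \<sigma>_def arnoldi_sigma_def sum_nonneg)
  ultimately have \<sigma>: "\<sigma> > 0" by (cases "\<sigma> = 0") auto
  have \<beta>: "\<beta> > 0" using assms(1) by (simp add: \<beta>_def)
  \<comment> \<open>Parseval for the orthonormal Arnoldi vectors: the norm of \<open>s\<close> is
    \<sigma>.\<close>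
  have "herm s s = (\<Sum>j=0..k. cnj (?q j) * cnj (herm (?v (Suc j)) s))"
    by (subst (2) s_def) (simp add: herm_sum_right herm_scale_right cnj_herm)
  also have "\<dots> = (\<Sum>j=0..k. complex_of_real ((cmod (?q j))\<^sup>2))"
    unfolding s_def
    by (intro sum.cong)
      (simp_all add: herm_sum_arnoldi_vec[OF nz] complex_norm_square[unfolded of_real_power] mult.commute)
  finally have "complex_of_real ((norm s)\<^sup>2) = complex_of_real (\<sigma>\<^sup>2)"
    by (simp add: herm_self \<sigma>2)
  then have "(norm s)\<^sup>2 = \<sigma>\<^sup>2" using of_real_eq_iff by blast
  then have norm_s: "norm s = \<sigma>" using \<sigma> by (simp add: power2_eq_iff_nonneg)
  have b: "b = \<beta> *\<^sub>R ?v 1" using \<beta> by (simp add: \<beta>_def arnoldi_vec.simps)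
  \<comment> \<open>With \<open>b\<close> a multiple of \<open>?v 1\<close> and \<sigma> squared
    expanded as a sum, each summand of \<open>r\<close> receives its own share of
    \<open>b\<close>.\<close>
  have "b - r = complex_of_real (\<beta> / \<sigma>\<^sup>2) *s
      (\<Sum>j=0..k. cnj (?q j) *s - (?v (Suc j) - ?q j *s ?v 1))"
  proof -
    have "(\<Sum>j=0..k. cnj (?q j) *s (?q j *s ?v 1)) = complex_of_real (\<sigma>\<^sup>2) *s ?v 1"
      unfolding \<sigma>2
      by (simp add: complex_norm_square[unfolded of_real_power] mult.commute flip: vec.scale_sum_left)
    moreover have "b = complex_of_real (\<beta> / \<sigma>\<^sup>2) *s (complex_of_real (\<sigma>\<^sup>2) *s ?v 1)"
      using \<sigma> by (subst b) (simp add: scaleR_eq_scalar_mult)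
    moreover have "(\<Sum>j=0..k. cnj (?q j) *s - (?v (Suc j) - ?q j *s ?v 1))
        = (\<Sum>j=0..k. cnj (?q j) *s (?q j *s ?v 1)) - s"
      by (simp only: s_def minus_diff_eq vec.scale_right_diff_distrib sum_subtractf)
    ultimately show ?thesis
      by (simp add: r_def scaleR_eq_scalar_mult vec.scale_right_diff_distrib)
  qed
  also have "\<dots> \<in> ?S"
    by (intro vec.subspace_scale vec.subspace_sum vec.subspace_neg subspace_gmres_space
        arnoldi_vec_diff_in_gmres_space nz) auto
  finally have in_S: "b - r \<in> ?S" .
  have orth: "herm r y = 0" if "y \<in> ?S" for y
  proof -
    have "herm s y = 0" unfolding s_def using herm_kernel_gmres_space[OF nz that] .
    then have "herm y r = 0"
      using cnj_herm[of s y] by (simp add: r_def scaleR_eq_scalar_mult herm_scale_right)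
    then show ?thesis using cnj_herm[of y r] by simp
  qed
  have res: "gmres_residual A b \<delta> k = r"
  \<comment> \<open>For \<open>k = 0\<close> no minimization occurs: the residual is
    \<open>b\<close> by definition, and the zero space forces \<open>b = r\<close>.\<close>
  proof (cases "k = 0")
    case True
    then have "?S = {0}" by (simp add: gmres_space_def)
    with in_S True show ?thesis by (simp add: gmres_residual_def)
  next
    case False
    have "closest_point ?S b = b - r"
      by (rule closest_point_subspace_unique[OF subspace_gmres_space in_S]) (simp add: orth)
    with False show ?thesis by (simp add: gmres_residual_def)
  qed
  \<comment> \<open>Dividing \<open>r\<close> by this norm leaves the factor
    \<open>1 / \<sigma>\<close>, and its positivity shows that the residual is nonzero.\<close>
  have norm_r: "norm r = \<beta> / \<sigma>"
    using \<sigma> \<beta> by (simp add: r_def norm_s power2_eq_square)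
  have "poly_mat (smult (complex_of_real (1 / \<sigma>\<^sup>2))
      (\<Sum>j=0..k. smult (cnj (?q j)) (arnoldi_poly A b j))) A *v b
    = complex_of_real (1 / \<sigma>\<^sup>2) *s (\<Sum>j=0..k. cnj (?q j) *s (complex_of_real \<beta> *s ?v (Suc j)))"
    unfolding poly_mat_smult poly_mat_sum \<beta>_def
    by (intro arg_cong[where f = "\<lambda>x. _ *s x"] sum.cong refl)
      (simp add: poly_mat_arnoldi_poly[OF assms(1)] nz)
  also have "\<dots> = r"
    by (simp add: r_def s_def scaleR_eq_scalar_mult vec.scale_sum_right mult_ac)
  finally show ?thesis
    using \<sigma> \<beta> norm_r
    by (auto simp: res \<sigma>_def[symmetric] gmres_residual_def[of _ _ _ 0] gmres_residual_normalized_def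
        r_def s_def[symmetric] power2_eq_square)
qed

end
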